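(* Let $(X(t))_{t\in\mathbb N}$, $X(t)=(x_1(t),\dots,x_V(t))\in\mathbb R^{n\times V}$, be the sequence generated by DJ-IST. There exists a time $t_1\in\mathbb N$ at which the sequence $\mathds 1(X(t))=(\mathds 1(x_1(t)),\dots,\mathds 1(x_V(t)))$ stabilizes, that is, $\mathds 1(X(t))$ is constant for all $t\ge t_1$.
   Context: Setting. $\mathcal G=(\mathcal V,\mathcal E)$ is a finite undirected graph with $|\mathcal V|=V$. For $v\in\mathcal V$, $\mathcal N_v$ denotes the set consisting of $v$ and its neighbours, $d_v=|\mathcal N_v|$. Each node $v$ has a matrix $A_v\in\mathbb R^{m\times n}$ ($m<n$) and a vector $y_v\in\mathbb R^m$. Fixed parameters: $\tau,\lambda,\alpha,\beta>0$ and $p\in\mathbb N$. For $x\in\mathbb R^n$, $\mathds 1(x)\in\{0,1\}^n$ has $i$-th entry $1$ if $x_i\ne0$ and $0$ if $x_i=0$; for scalars, $\mathds 1(x_{v,i})$ is defined likewise. The local average is $\overline{\mathds 1(x_{v,i})}=\frac1{d_v}\sum_{u\in\mathcal N_v}\mathds 1(x_{u,i})$. Write $[z]_+=\max\{0,z\}$. Soft thresholding: for $w\ge0$, $\mathbb S_w(x)=0$ if $|x|\le w$ and $\mathbb S_w(x)=x-\mathrm{sgn}(x)w$ otherwise. Algorithm DJ-IST. Initialize $x_v(0)=A_v^{\mathsf T}y_v$ and counters $c_{v,i}(0)=0$. At each $t=0,1,2,\dots$, for all $v\in\mathcal V$ and $i=1,\dots,n$: $z_v(t)=x_v(t)+\tau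 A_v^{\mathsf T}(y_v-A_vx_v(t))$; $w_{v,i}(t)=[\beta-\alpha|x_{v,i}(t)|-\overline{\mathds 1(x_{v,i}(t))}]_+$; $x_{v,i}(t+1)=0$ if $x_{v,i}(t)=0$ and $c_{v,i}(t)\ge p$, and $x_{v,i}(t+1)=\mathbb S_{\lambda\alpha w_{v,i}(t)}(z_{v,i}(t))$ otherwise; $c_{v,i}(t+1)=c_{v,i}(t)+1$ if $x_{v,i}(t)=0$ and $x_{v,i}(t+1)\ne0$, and $c_{v,i}(t+1)=c_{v,i}(t)$ otherwise. All nodes update synchronously and the iteration is run for all $t\in\mathbb N$ (no stopping rule). *)

theory Defs
  imports "HOL-Analysis.Analysis"
begin

(* The vertex set is the finite type 'v and an edge is an unordered pair {u, v} of vertices.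
   Loops are not excluded; they have no effect, since nbhd E v contains v in any case. *)
definition undirected_graph :: "'v set set \<Rightarrow> bool" where
  "undirected_graph E \<longleftrightarrow> (\<forall>e\<in>E. \<exists>u v. e = {u, v})"

definition nbhd :: "'v set set \<Rightarrow> 'v \<Rightarrow> 'v set" where
  "nbhd E v = insert v {u. {u, v} \<in> E}"

definition ind :: "real \<Rightarrow> real" where
  "ind x = (if x \<noteq> 0 then 1 else 0)"

definition ind_vec :: "real ^ 'n \<Rightarrow> real ^ 'n" where
  "ind_vec x = (\<chi> i. ind (x $ i))"

definition local_avg :: "'v set set \<Rightarrow> ('v::finite \<Rightarrow> real ^ 'n) \<Rightarrow> 'v \<Rightarrow> 'n \<Rightarrow> real" where
  "local_avg E x v i = 1 / real (card (nbhd E v)) * (\<Sum>u\<in>nbhd E v. ind (x u $ i))"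

definition soft :: "real \<Rightarrow> real \<Rightarrow> real" where
  "soft w x = (if \<bar>x\<bar> \<le> w then 0 else x - sgn x * w)"

definition pos_part :: "real \<Rightarrow> real" where
  "pos_part z = max 0 z"

definition gradient_step ::
  "('v \<Rightarrow> real ^ 'n ^ 'm) \<Rightarrow> ('v \<Rightarrow> real ^ 'm) \<Rightarrow> real \<Rightarrow> ('v \<Rightarrow> real ^ 'n) \<Rightarrow> 'v \<Rightarrow> real ^ 'n" where
  "gradient_step A y \<tau> x v = x v + \<tau> *\<^sub>R (transpose (A v) *v (y v - A v *v x v))"

definition weight ::
  "'v set set \<Rightarrow> real \<Rightarrow> real \<Rightarrow> ('v::finite \<Rightarrow> real ^ 'n) \<Rightarrow> 'v \<Rightarrow> 'n \<Rightarrow> real" where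
  "weight E \<alpha> \<beta> x v i = pos_part (\<beta> - \<alpha> * \<bar>x v $ i\<bar> - local_avg E x v i)"

definition next_x ::
  "'v set set \<Rightarrow> ('v::finite \<Rightarrow> real ^ 'n ^ 'm) \<Rightarrow> ('v \<Rightarrow> real ^ 'm) \<Rightarrow>
   real \<Rightarrow> real \<Rightarrow> real \<Rightarrow> real \<Rightarrow> nat \<Rightarrow>
   ('v \<Rightarrow> real ^ 'n) \<Rightarrow> ('v \<Rightarrow> 'n \<Rightarrow> nat) \<Rightarrow> 'v \<Rightarrow> real ^ 'n" where
  "next_x E A y \<tau> l \<alpha> \<beta> p x c v =
     (\<chi> i. if x v $ i = 0 \<and> c v i \<ge> p then 0
           else soft (l * \<alpha> * weight E \<alpha> \<beta> x v i) (gradient_step A y \<tau> x v $ i))"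

definition next_c ::
  "('v \<Rightarrow> real ^ 'n) \<Rightarrow> ('v \<Rightarrow> real ^ 'n) \<Rightarrow> ('v \<Rightarrow> 'n \<Rightarrow> nat) \<Rightarrow> 'v \<Rightarrow> 'n \<Rightarrow> nat" where
  "next_c x x' c v i = (if x v $ i = 0 \<and> x' v $ i \<noteq> 0 then c v i + 1 else c v i)"

(* The state at time t is the pair (X(t), c(t)) of all local estimates and all counters;
   the parameter l is the paper's lambda. *)
primrec dj_ist_state ::
  "'v set set \<Rightarrow> ('v::finite \<Rightarrow> real ^ 'n ^ 'm) \<Rightarrow> ('v \<Rightarrow> real ^ 'm) \<Rightarrow>
   real \<Rightarrow> real \<Rightarrow> real \<Rightarrow> real \<Rightarrow> nat \<Rightarrow> nat \<Rightarrow>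
   ('v \<Rightarrow> real ^ 'n) \<times> ('v \<Rightarrow> 'n \<Rightarrow> nat)" where
  "dj_ist_state E A y \<tau> l \<alpha> \<beta> p 0 = (\<lambda>v. transpose (A v) *v y v, \<lambda>v i. 0)"
| "dj_ist_state E A y \<tau> l \<alpha> \<beta> p (Suc t) =
     (let (x, c) = dj_ist_state E A y \<tau> l \<alpha> \<beta> p t;
          x' = next_x E A y \<tau> l \<alpha> \<beta> p x c
      in (x', next_c x x' c))"

definition dj_ist ::
  "'v set set \<Rightarrow> ('v::finite \<Rightarrow> real ^ 'n ^ 'm) \<Rightarrow> ('v \<Rightarrow> real ^ 'm) \<Rightarrow>
   real \<Rightarrow> real \<Rightarrow> real \<Rightarrow> real \<Rightarrow> nat \<Rightarrow> nat \<Rightarrow> 'v \<Rightarrow> real ^ 'n" where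
  "dj_ist E A y \<tau> l \<alpha> \<beta> p t = fst (dj_ist_state E A y \<tau> l \<alpha> \<beta> p t)"

definition ind_family :: "('v \<Rightarrow> real ^ 'n) \<Rightarrow> 'v \<Rightarrow> real ^ 'n" where
  "ind_family X = (\<lambda>v. ind_vec (X v))"

end

theory Submission
  imports Defs
begin

text \<open>
  An entry of the iterate can leave the value zero at most \<open>p\<close> times: every such activation raises
  the counter of the entry, and once the counter has reached \<open>p\<close> a zero entry is kept at zero.
  Between two activations of an entry there is at most one deactivation, so each entry of the
  indicator changes only finitely often. As there are finitely many entries, all of them have
  settled after some common time.

  The number of changes is recorded by a single natural number per entry, \<open>switch_count\<close>. It is
  nondecreasing (\<open>switch_count_mono\<close>) and bounded by \<open>2 * p + 1\<close> (\<open>switch_count_le\<close>), hence eventually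
  constant, and its parity is the indicator of the entry (\<open>ind_eq_parity_switch_count\<close>).
\<close>

lemma bounded_incseq_nat_eventually_const:
  fixes f :: "nat \<Rightarrow> nat"
  assumes "mono f" and bound: "\<And>t. f t \<le> B"
  shows "\<exists>M. \<forall>\<^sub>F t in sequentially. f t = M"
proof -
  have "finite (range f)"
    using bound by (intro finite_subset[of "range f" "{..B}"]) auto
  then have "Max (range f) \<in> range f"
    by (intro Max_in) auto
  then obtain s where "f s = Max (range f)"
    by force
  then have "f t \<le> f s" for t
    using \<open>finite (range f)\<close> by simp
  then have "\<forall>t\<ge>s. f t = f s"
    using \<open>mono f\<close> by (simp add: le_antisym monoD)
  then show ?thesis
    unfolding eventually_sequentially by blast
qed

text \<open>
  Each activation raises the counter by one and removes the summand for a zero entry, each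
  deactivation adds that summand: both raise the value by one, and nothing else changes it. Up to
  its initial value this is therefore the number of times the indicator of the entry has changed.
\<close>
definition switch_count ::
  "('v \<Rightarrow> real ^ 'n) \<times> ('v \<Rightarrow> 'n \<Rightarrow> nat) \<Rightarrow> 'v \<Rightarrow> 'n \<Rightarrow> nat" where
  "switch_count s v i = 2 * snd s v i + (if fst s v $ i = 0 then 1 else 0)"

lemma ind_eq_parity_switch_count:
  "ind (fst s v $ i) = (if even (switch_count s v i) then 1 else 0)"
  by (simp add: ind_def switch_count_def)

lemma switch_count_mono:
  "mono (\<lambda>t. switch_count (dj_ist_state E A y \<tau> l \<alpha> \<beta> p t) v i)"
  by (rule incseq_SucI) (simp add: switch_count_def next_c_def Let_def case_prod_beta)

text \<open>A counter is raised only when its entry leaves zero, which the update rule prevents once the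
  counter has reached \<open>p\<close>.\<close>
lemma counter_le:
  "snd (dj_ist_state E A y \<tau> l \<alpha> \<beta> p t) v i \<le> p"
  by (induction t) (auto simp: next_c_def next_x_def Let_def case_prod_beta)

lemma switch_count_le:
  "switch_count (dj_ist_state E A y \<tau> l \<alpha> \<beta> p t) v i \<le> 2 * p + 1"
  using counter_le[of E A y \<tau> l \<alpha> \<beta> p t v i] by (simp add: switch_count_def)

theorem theorem1:
  fixes E :: "'v::finite set set"
    and A :: "'v \<Rightarrow> real ^ 'n ^ 'm"
    and y :: "'v \<Rightarrow> real ^ 'm"
    and \<tau> l \<alpha> \<beta> :: real and p :: nat
  assumes "undirected_graph E"
    and "CARD('m) < CARD('n)"
    and "\<tau> > 0" and "l > 0" and "\<alpha> > 0" and "\<beta> > 0"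
  shows "\<exists>t1. \<forall>t\<ge>t1. ind_family (dj_ist E A y \<tau> l \<alpha> \<beta> p t)
                      = ind_family (dj_ist E A y \<tau> l \<alpha> \<beta> p t1)"
proof -
  let ?s = "dj_ist_state E A y \<tau> l \<alpha> \<beta> p"
  have "\<exists>M. \<forall>\<^sub>F t in sequentially. switch_count (?s t) v i = M" for v i
    by (rule bounded_incseq_nat_eventually_const[OF switch_count_mono switch_count_le])
  then obtain M where "\<And>v i. \<forall>\<^sub>F t in sequentially. switch_count (?s t) v i = M v i"
    by metis
  \<comment> \<open>Finiteness of the sets of nodes and of coordinates gives one time for all entries.\<close>
  then have "\<forall>\<^sub>F t in sequentially. \<forall>v i. switch_count (?s t) v i = M v i"
    by (intro eventually_all_finite)
  then obtain t1 where t1: "\<And>t v i. t \<ge> t1 \<Longrightarrow> switch_count (?s t) v i = M v i"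
    by (auto simp: eventually_sequentially)
  have "ind_family (dj_ist E A y \<tau> l \<alpha> \<beta> p t)
      = (\<lambda>v. \<chi> i. if even (M v i) then 1 else 0)" if "t \<ge> t1" for t
    using t1[OF that]
    by (simp add: ind_family_def ind_vec_def dj_ist_def ind_eq_parity_switch_count)
  then show ?thesis
    by (intro exI[of _ t1]) simp
qed

end
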